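(* Let $n\ge 1$ be an integer and let $Q'_n(8,4)$ be the cylinder graph of the linear octagonal-quadrilateral network. Then $$W\big(Q'_n(8,4)\big)=32n^3+16n^2+8n.$$
   Context: The graph $Q'_n(8,4)$ is the simple undirected graph with $8n$ vertices $1,2,\dots,4n,1',2',\dots,(4n)'$ and the following $10n$ edges: the path edges $\{j,j+1\}$ and $\{j',(j+1)'\}$ for $1\le j\le 4n-1$; the rungs $\{j,j'\}$ for all $1\le j\le 4n$ with $j\equiv 0$ or $1 \pmod 4$; and the two untwisted closing edges $\{4n,1\}$ and $\{(4n)',1'\}$. For a connected graph $G$, the Wiener index is $W(G)=\sum_{i<j} d_{ij}$, where $d_{ij}$ is the length of a shortest path between vertices $i$ and $j$, and the sum is over all unordered pairs of distinct vertices. *)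

theory Defs
  imports "Graph_Theory.Graph_Theory" "HOL-Library.Product_Lexorder"
begin

text \<open>
  The distance is the library's minimum walk cost for the weight that is constantly 1, i.e. the
  minimum number of arcs of a walk. It is an extended real, infinite when there is no walk, so a
  finite Wiener index entails that the (symmetric) graph is connected.
\<close>

definition graph_dist :: "('a, 'b) pre_digraph \<Rightarrow> 'a \<Rightarrow> 'a \<Rightarrow> ereal" where
  "graph_dist G u v = wf_digraph.\<mu> G (\<lambda>_. 1) u v"

definition wiener_index :: "('a::linorder, 'b) pre_digraph \<Rightarrow> ereal" where
  "wiener_index G =
     (\<Sum>(u, v)\<in>{(u, v). u \<in> verts G \<and> v \<in> verts G \<and> u < v}. graph_dist G u v)"

text \<open>
  The vertex \<open>j\<close> is \<open>(j, False)\<close> and the vertex \<open>j'\<close> is \<open>(j, True)\<close>.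
\<close>

definition cyl_verts :: "nat \<Rightarrow> (nat \<times> bool) set" where
  "cyl_verts n = {1..4 * n} \<times> UNIV"

definition cyl_edges :: "nat \<Rightarrow> (nat \<times> bool) set set" where
  "cyl_edges n =
     {{(j, b), (j + 1, b)} | j b. 1 \<le> j \<and> j \<le> 4 * n - 1}
   \<union> {{(j, False), (j, True)} | j. 1 \<le> j \<and> j \<le> 4 * n \<and> (j mod 4 = 0 \<or> j mod 4 = 1)}
   \<union> {{(4 * n, b), (1, b)} | b. True}"

text \<open>
  As usual in the library, an undirected graph is a symmetric digraph: each edge \<open>{u, v}\<close>
  gives the two arcs \<open>(u, v)\<close> and \<open>(v, u)\<close>.
\<close>

definition Q' :: "nat \<Rightarrow> (nat \<times> bool) pair_pre_digraph" where
  "Q' n = \<lparr> pverts = cyl_verts n, parcs = {(u, v). {u, v} \<in> cyl_edges n} \<rparr>"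

lemma cyl_edges_subset:
  assumes "n \<ge> 1" and "e \<in> cyl_edges n"
  shows "e \<subseteq> cyl_verts n"
  using assms by (auto simp: cyl_edges_def cyl_verts_def)

lemma cyl_edges_no_loop: "{u} \<notin> cyl_edges n"
  by (auto simp: cyl_edges_def)

lemma pair_graph_Q':
  assumes "n \<ge> 1"
  shows "pair_graph (Q' n)"
proof
  have sub: "parcs (Q' n) \<subseteq> cyl_verts n \<times> cyl_verts n"
    using cyl_edges_subset[OF assms] by (auto simp: Q'_def)
  have fin: "finite (cyl_verts n)" by (simp add: cyl_verts_def)
  show "fst e \<in> pverts (Q' n)" "snd e \<in> pverts (Q' n)" if "e \<in> parcs (Q' n)" for e
    using subsetD[OF sub that] by (auto simp: Q'_def)
  show "finite (pverts (Q' n))" using fin by (simp add: Q'_def)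
  show "finite (parcs (Q' n))" using finite_subset[OF sub] fin by simp
  show "fst e \<noteq> snd e" if "e \<in> parcs (Q' n)" for e
    using that cyl_edges_no_loop by (auto simp: Q'_def)
  show "symmetric (Q' n)"
    by (auto simp: symmetric_def sym_def Q'_def insert_commute)
qed

end

theory Submission
  imports Defs
begin

text \<open>
  The columns of the cylinder form a ring of length \<open>4 n\<close>, and every edge either stays in a
  column (a rung) or moves to a neighbouring column of the ring. Inside a layer, distances are
  therefore ring distances. A path from one layer to the other needs a rung, and it costs just one
  step more than the ring distance as soon as a shortest route along the ring meets a rung column.
  Columns \<open>4 q + 1\<close> and \<open>4 q + 4\<close> are rungs, so the only column pairs whose shortest route avoids
  all rungs have both members in \<open>{4 q + 2, 4 q + 3}\<close> for the same \<open>q\<close>; such a pair needs a detour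
  of one step out to the nearest rung column and one step back, two extra steps. This explains the
  closed form \<open>cyl_dist\<close>, whose correctness is \<open>graph_dist_cylinder\<close>.

  Summing \<open>cyl_dist\<close> over all ordered pairs of vertices counts every unordered pair twice. An
  ordered pair of columns accounts for four ordered pairs of vertices, two of which cross between
  the layers. Each of the \<open>4 n\<close> columns has total ring distance \<open>4 n\<^sup>2\<close>, so the ring distances
  contribute \<open>4 \<cdot> 4 n \<cdot> 4 n\<^sup>2 = 64 n\<^sup>3\<close>. The rung steps contribute \<open>2 \<cdot> (4 n)\<^sup>2 = 32 n\<^sup>2\<close>. There are
  \<open>4 n\<close> ordered pairs of columns with a detour, contributing \<open>2 \<cdot> 2 \<cdot> 4 n = 16 n\<close>. Halving gives
  \<open>32 n\<^sup>3 + 16 n\<^sup>2 + 8 n\<close>.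
\<close>

section \<open>Distances from a potential\<close>

text \<open>
  A guessed distance to \<open>v\<close> can be verified locally. If it never drops by more than one along an
  arc, no walk to \<open>v\<close> is shorter than the guess; if from every other vertex some arc lowers it by
  one, following such arcs gives a walk of exactly the guessed length.
\<close>
lemma graph_dist_eqI:
  fixes D :: "'a \<Rightarrow> nat"
  assumes wf: "wf_digraph G" and u: "u \<in> verts G"
    and zero: "D v = 0"
    and lipschitz: "\<And>e. e \<in> arcs G \<Longrightarrow> D (tail G e) \<le> Suc (D (head G e))"
    and descent: "\<And>x. x \<in> verts G \<Longrightarrow> x \<noteq> v \<Longrightarrow>
      \<exists>e\<in>arcs G. tail G e = x \<and> D x = Suc (D (head G e))"
  shows "graph_dist G u v = ereal (D u)"
proof -
  interpret wf_digraph G by (rule wf)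
  have cost: "awalk_cost (\<lambda>_. 1) p = real (length p)" for p
    by (induct p) auto
  have lower: "D x \<le> length p" if "awalk x p v" for x p
    using that
  proof (induct p arbitrary: x)
    case Nil
    then show ?case using zero by (simp add: awalk_Nil_iff)
  next
    case (Cons e p)
    then have "e \<in> arcs G" "tail G e = x" "awalk (head G e) p v"
      by (auto simp: awalk_Cons_iff)
    with Cons.hyps[of "head G e"] lipschitz[of e] show ?case by simp
  qed
  have upper: "\<exists>p. awalk x p v \<and> length p = D x" if "x \<in> verts G" for x
    using that
  proof (induct "D x" arbitrary: x)
    case 0
    with descent[of x] have "x = v" by auto
    with 0 show ?case by (auto intro!: exI[of _ "[]"] simp: awalk_Nil_iff)
  next
    case (Suc d)
    with zero have "x \<noteq> v" by auto
    with descent[of x] Suc.prems obtain e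
      where e: "e \<in> arcs G" "tail G e = x" "D x = Suc (D (head G e))" by blast
    with Suc have "d = D (head G e)" by simp
    with Suc.hyps(1)[of "head G e"] e(1) obtain p
      where "awalk (head G e) p v" "length p = D (head G e)" by auto
    with e show ?case
      by (auto intro!: exI[of _ "e # p"] simp: awalk_Cons_iff)
  qed
  from upper[OF u] obtain p where p: "awalk u p v" "length p = D u" by blast
  have "\<mu> (\<lambda>_. 1) u v = ereal (D u)"
    unfolding \<mu>_def cost
  proof (rule INF_eqI)
    fix q assume "q \<in> {p. awalk u p v}"
    with lower[of u q] show "ereal (D u) \<le> ereal (real (length q))" by simp
  next
    fix y assume "\<And>q. q \<in> {p. awalk u p v} \<Longrightarrow> y \<le> ereal (real (length q))"
    from this[of p] p show "y \<le> ereal (D u)" by simp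
  qed
  then show ?thesis by (simp add: graph_dist_def)
qed

lemma sum_less_pairs_symmetric:
  fixes f :: "'a::linorder \<Rightarrow> 'a \<Rightarrow> nat"
  assumes fin: "finite V" and sym: "\<And>u v. f u v = f v u" and diag: "\<And>u. f u u = 0"
  shows "2 * (\<Sum>(u, v)\<in>{(u, v). u \<in> V \<and> v \<in> V \<and> u < v}. f u v) = (\<Sum>u\<in>V. \<Sum>v\<in>V. f u v)"
proof -
  let ?L = "{(u, v). u \<in> V \<and> v \<in> V \<and> u < v}"
  let ?R = "{(u, v). u \<in> V \<and> v \<in> V \<and> v < u}"
  let ?I = "{(u, v). u \<in> V \<and> v \<in> V \<and> u = v}"
  have split: "V \<times> V = (?L \<union> ?R) \<union> ?I" by auto
  have finL: "finite ?L" and finR: "finite ?R" and finI: "finite ?I"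
    by (rule finite_subset[of _ "V \<times> V"]; use fin in auto)+
  have swap: "(\<Sum>(u, v)\<in>?R. f u v) = (\<Sum>(u, v)\<in>?L. f u v)"
    by (rule sum.reindex_bij_witness[of _ prod.swap prod.swap]) (auto simp: sym)
  have zero: "(\<Sum>(u, v)\<in>?I. f u v) = 0"
    by (rule sum.neutral) (auto simp: diag)
  have "(\<Sum>u\<in>V. \<Sum>v\<in>V. f u v) = (\<Sum>(u, v)\<in>V \<times> V. f u v)"
    by (simp add: sum.cartesian_product)
  also have "\<dots> = (\<Sum>(u, v)\<in>?L. f u v) + (\<Sum>(u, v)\<in>?R. f u v) + (\<Sum>(u, v)\<in>?I. f u v)"
    unfolding split using finL finR finI
    by (subst sum.union_disjoint, auto)+
  finally show ?thesis using swap zero by simp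
qed

section \<open>The distance function of the cylinder\<close>

definition ring_dist :: "nat \<Rightarrow> nat \<Rightarrow> nat \<Rightarrow> nat" where
  "ring_dist N i j = min ((i - j) + (j - i)) (N - ((i - j) + (j - i)))"

definition ring_adj :: "nat \<Rightarrow> nat \<Rightarrow> nat \<Rightarrow> bool" where
  "ring_adj N i j \<longleftrightarrow> j = i + 1 \<or> i = j + 1 \<or> i = N \<and> j = 1 \<or> i = 1 \<and> j = N"

text \<open>
  The residues 2 and 3 mark the columns without a rung. Since a rung column has residue 0 or 1, two
  consecutive rungless columns share their quotient by 4, and this quotient identifies the pair.
\<close>
definition detour :: "nat \<Rightarrow> nat \<Rightarrow> nat" where
  "detour i j = (if i mod 4 \<ge> 2 \<and> j mod 4 \<ge> 2 \<and> i div 4 = j div 4 then 2 else 0)"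

definition cyl_dist :: "nat \<Rightarrow> nat \<times> bool \<Rightarrow> nat \<times> bool \<Rightarrow> nat" where
  "cyl_dist n u v = ring_dist (4 * n) (fst u) (fst v) +
     (if snd u = snd v then 0 else 1 + detour (fst u) (fst v))"

lemma cyl_arc_iff:
  assumes "n \<ge> 1"
  shows "((i, a), (k, b)) \<in> parcs (Q' n) \<longleftrightarrow>
    i \<in> {1..4 * n} \<and> k \<in> {1..4 * n} \<and>
    (if a = b then ring_adj (4 * n) i k else i = k \<and> i mod 4 < 2)"
proof -
  have m: "i mod 4 < 2 \<longleftrightarrow> i mod 4 = 0 \<or> i mod 4 = 1" for i :: nat by auto
  show ?thesis
    unfolding m using assms
    by (cases a; cases b) (auto simp: Q'_def cyl_edges_def ring_adj_def doubleton_eq_iff)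
qed

lemma ring_dist_self: "ring_dist N i i = 0"
  by (simp add: ring_dist_def)

lemma ring_dist_commute: "ring_dist N i j = ring_dist N j i"
  by (simp add: ring_dist_def add.commute)

text \<open>
  A step along the ring changes the unwrapped distance \<open>t\<close> by one, except that a closing edge
  replaces \<open>t\<close> by \<open>N - 1 - t\<close>; as \<open>min t (N - t)\<close> is invariant under \<open>t \<mapsto> N - t\<close>, that too is a
  change by at most one after wrapping.
\<close>
lemma ring_dist_lipschitz:
  assumes i: "i \<in> {1..N}" and k: "k \<in> {1..N}" and j: "j \<in> {1..N}" and adj: "ring_adj N i k"
  shows "ring_dist N i j \<le> Suc (ring_dist N k j)"
proof -
  define t s where "t = (i - j) + (j - i)" and "s = (k - j) + (j - k)"
  have "s \<le> N" "t \<le> N" using i k j by (auto simp: t_def s_def)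
  moreover have "s = t + 1 \<or> t = s + 1 \<or> s + t + 1 = N"
    using i k j adj unfolding ring_adj_def t_def s_def atLeastAtMost_iff
    by (elim disjE conjE) auto
  ultimately have "min t (N - t) \<le> Suc (min s (N - s))" by linarith
  then show ?thesis by (simp add: ring_dist_def t_def s_def)
qed

text \<open>
  One of the two ring neighbours of \<open>i\<close> always lies on the shorter arc towards \<open>j\<close>.
\<close>
lemma ring_dist_descent:
  assumes i: "i \<in> {1..N}" and j: "j \<in> {1..N}" and "i \<noteq> j"
  shows "\<exists>k\<in>{1..N}. ring_adj N i k \<and> ring_dist N i j = Suc (ring_dist N k j)"
proof -
  define s where "s = (if i < N then i + 1 else 1)"
  define p where "p = (if i > 1 then i - 1 else N)"
  have nb: "s \<in> {1..N}" "p \<in> {1..N}" "ring_adj N i s" "ring_adj N i p"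
    using i by (auto simp: s_def p_def ring_adj_def)
  consider (less) d where "j = i + d" "d > 0" | (greater) d where "i = j + d" "d > 0"
    using \<open>i \<noteq> j\<close> by (metis linorder_neqE_nat less_imp_add_positive)
  then have "ring_dist N i j = Suc (ring_dist N s j) \<or> ring_dist N i j = Suc (ring_dist N p j)"
  proof cases
    case less
    have "ring_dist N i j = min d (N - d)" by (simp add: ring_dist_def less)
    moreover have "ring_dist N s j = min (d - 1) (N - (d - 1))"
      using less i j by (auto simp: ring_dist_def s_def)
    moreover have "ring_dist N p j = min (d + 1) (N - (d + 1))"
      using less i j by (auto simp: ring_dist_def p_def min_def)
    moreover have "d < N" using less i j by auto
    ultimately show ?thesis using \<open>d > 0\<close> by (cases "2 * d \<le> N") linarith+
  next
    case greater
    have "ring_dist N i j = min d (N - d)" by (simp add: ring_dist_def greater)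
    moreover have "ring_dist N p j = min (d - 1) (N - (d - 1))"
      using greater i j by (auto simp: ring_dist_def p_def)
    moreover have "ring_dist N s j = min (d + 1) (N - (d + 1))"
      using greater i j by (auto simp: ring_dist_def s_def min_def)
    moreover have "d < N" using greater i j by auto
    ultimately show ?thesis using \<open>d > 0\<close> by (cases "2 * d \<le> N") linarith+
  qed
  with nb show ?thesis by blast
qed

lemma detour_commute: "detour i j = detour j i"
  by (auto simp: detour_def)

lemma cyl_dist_self: "cyl_dist n u u = 0"
  by (simp add: cyl_dist_def ring_dist_self)

lemma cyl_dist_commute: "cyl_dist n u v = cyl_dist n v u"
  by (auto simp: cyl_dist_def ring_dist_commute[of _ "fst u"] detour_commute[of "fst u"])

lemma detour_within_block:
  assumes "i = 4 * q + 2 \<or> i = 4 * q + 3" "j = 4 * q + 2 \<or> j = 4 * q + 3"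
  shows "detour i j = 2"
proof -
  have "(4 * q + 2) mod 4 = 2" "(4 * q + 3) mod 4 = 3" "(4 * q + 2) div 4 = q" "(4 * q + 3) div 4 = q"
    by presburger+
  then show ?thesis using assms unfolding detour_def by (elim disjE) simp_all
qed

lemma detour_nonzeroE:
  assumes "detour i j \<noteq> 0"
  obtains q where "i = 4 * q + 2 \<or> i = 4 * q + 3" "j = 4 * q + 2 \<or> j = 4 * q + 3" "detour i j = 2"
proof -
  have *: "i mod 4 \<ge> 2" "j mod 4 \<ge> 2" "i div 4 = j div 4" "detour i j = 2"
    using assms by (auto simp: detour_def split: if_splits)
  have "x = 4 * (x div 4) + 2 \<or> x = 4 * (x div 4) + 3" if "x mod 4 \<ge> 2" for x :: nat
    using that by presburger
  with * that show ?thesis by metis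
qed

text \<open>
  The detour can drop by two in a single step, but only when a step from a rungless column reaches
  an adjacent rung column. That step leads away from \<open>j\<close>, so the ring distance grows by one and
  the sum still drops by only one.
\<close>
lemma ring_dist_detour_lipschitz:
  assumes n: "i \<in> {1..4 * n}" "k \<in> {1..4 * n}" "j \<in> {1..4 * n}" "ring_adj (4 * n) i k"
  shows "ring_dist (4 * n) i j + detour i j \<le> Suc (ring_dist (4 * n) k j + detour k j)"
proof (cases "detour i j = 0 \<or> detour k j = 2")
  case True
  with ring_dist_lipschitz[OF n] show ?thesis by (auto simp: detour_def)
next
  case False
  then have "detour i j \<noteq> 0" by simp
  then obtain q where q: "i = 4 * q + 2 \<or> i = 4 * q + 3" "j = 4 * q + 2 \<or> j = 4 * q + 3"
    "detour i j = 2" by (rule detour_nonzeroE)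
  have "k \<noteq> 4 * q + 2" "k \<noteq> 4 * q + 3"
    using False q(2) detour_within_block by blast+
  moreover have "i \<noteq> 4 * n" "i \<noteq> 1" using q(1) by presburger+
  ultimately have k: "i = 4 * q + 2 \<and> k = 4 * q + 1 \<or> i = 4 * q + 3 \<and> k = 4 * q + 4"
    using q(1) n(4) by (auto simp: ring_adj_def)
  have "q < n" using n q by auto
  with k q(2) have "ring_dist (4 * n) k j = Suc (ring_dist (4 * n) i j)"
    unfolding ring_dist_def by auto
  with q(3) show ?thesis by simp
qed

text \<open>
  The descending arc at a vertex is the rung, if there is one and the other layer has to be reached;
  the step to the adjacent rung column, if a detour is needed; and otherwise a step on a shortest
  route along the ring, which cannot create a detour because from a rungless column it never enters
  the pair of rungless columns containing the target.
\<close>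
lemma graph_dist_cylinder:
  assumes n: "n \<ge> 1" and u: "u \<in> cyl_verts n" and v: "v \<in> cyl_verts n"
  shows "graph_dist (with_proj (Q' n)) u v = ereal (cyl_dist n u v)"
proof -
  interpret pair_graph "Q' n" using n by (rule pair_graph_Q')
  obtain j b where vj: "v = (j, b)" and j: "j \<in> {1..4 * n}"
    using v by (cases v) (auto simp: cyl_verts_def)
  show ?thesis
  proof (rule graph_dist_eqI)
    show "wf_digraph (with_proj (Q' n))" by unfold_locales
    show "u \<in> verts (with_proj (Q' n))" using u by (simp add: Q'_def)
    show "cyl_dist n v v = 0" by (rule cyl_dist_self)
  next
    fix e assume "e \<in> arcs (with_proj (Q' n))"
    moreover obtain i a k c where e: "e = ((i, a), (k, c))" by (metis surj_pair)
    ultimately have arc: "((i, a), (k, c)) \<in> parcs (Q' n)" by simp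
    note arc = arc[unfolded cyl_arc_iff[OF n]]
    have "cyl_dist n (i, a) v \<le> Suc (cyl_dist n (k, c) v)"
    proof (cases "a = c")
      case True
      with arc have k: "i \<in> {1..4 * n}" "k \<in> {1..4 * n}" "ring_adj (4 * n) i k" by auto
      show ?thesis
        using ring_dist_lipschitz[OF k(1,2) j k(3)] ring_dist_detour_lipschitz[OF k(1,2) j k(3)] True
        by (simp add: cyl_dist_def vj)
    next
      case False
      with arc have "i = k" "i mod 4 < 2" by auto
      then show ?thesis by (auto simp: cyl_dist_def vj detour_def)
    qed
    then show "cyl_dist n (tail (with_proj (Q' n)) e) v \<le> Suc (cyl_dist n (head (with_proj (Q' n)) e) v)"
      by (simp add: e)
  next
    fix x assume x: "x \<in> verts (with_proj (Q' n))" "x \<noteq> v"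
    then obtain i a where xi: "x = (i, a)" and i: "i \<in> {1..4 * n}"
      by (cases x) (auto simp: Q'_def cyl_verts_def)
    have "\<exists>k c. ((i, a), (k, c)) \<in> parcs (Q' n) \<and> cyl_dist n (i, a) v = Suc (cyl_dist n (k, c) v)"
    proof (cases "a \<noteq> b \<and> i mod 4 < 2")
      case True
      then have "((i, a), (i, b)) \<in> parcs (Q' n)" using i by (auto simp: cyl_arc_iff[OF n])
      moreover have "cyl_dist n (i, a) v = Suc (cyl_dist n (i, b) v)"
        using True by (auto simp: cyl_dist_def vj detour_def)
      ultimately show ?thesis by blast
    next
      case F: False
      show ?thesis
      proof (cases "a \<noteq> b \<and> detour i j \<noteq> 0")
        case True
        then have "detour i j \<noteq> 0" by simp
        then obtain q where q: "i = 4 * q + 2 \<or> i = 4 * q + 3" "j = 4 * q + 2 \<or> j = 4 * q + 3"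
          "detour i j = 2" by (rule detour_nonzeroE)
        define k where "k = (if i = 4 * q + 2 then 4 * q + 1 else 4 * q + 4)"
        have qn: "q < n" using i q by auto
        have "((i, a), (k, a)) \<in> parcs (Q' n)"
          using q(1) qn i by (auto simp: cyl_arc_iff[OF n] k_def ring_adj_def)
        moreover have "ring_dist (4 * n) k j = Suc (ring_dist (4 * n) i j)"
          using q qn unfolding ring_dist_def k_def by auto
        moreover have "detour k j = 0"
          by (auto simp: detour_def k_def)
        ultimately show ?thesis
          using True q(3) by (auto simp: cyl_dist_def vj intro!: exI[of _ k] exI[of _ a])
      next
        case G: False
        have ij: "i \<noteq> j"
        proof
          assume ij: "i = j"
          with x xi vj have "a \<noteq> b" by auto
          with F G ij show False by (auto simp: detour_def split: if_splits)
        qed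
        from ring_dist_descent[OF i j ij] obtain k where k: "k \<in> {1..4 * n}"
          "ring_adj (4 * n) i k" "ring_dist (4 * n) i j = Suc (ring_dist (4 * n) k j)" by blast
        have "detour k j = 0" if ab: "a \<noteq> b"
        proof (rule ccontr)
          assume "detour k j \<noteq> 0"
          then obtain q where q: "k = 4 * q + 2 \<or> k = 4 * q + 3" "j = 4 * q + 2 \<or> j = 4 * q + 3"
            by (rule detour_nonzeroE)
          from ab F have i2: "i mod 4 \<ge> 2" by simp
          \<comment> \<open>The block is interior to the column numbering, so the closing edges do not reach it.\<close>
          have "k \<noteq> 4 * n" "k \<noteq> 1" using q(1) by presburger+
          then have "i = 4 * q + 1 \<or> i = 4 * q + 2 \<or> i = 4 * q + 3 \<or> i = 4 * q + 4"
            using q k(1,2) by (auto simp: ring_adj_def)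
          with i2 have "i = 4 * q + 2 \<or> i = 4 * q + 3" by presburger
          then have "detour i j = 2" using q(2) by (rule detour_within_block)
          with ab G show False by simp
        qed
        with G k i show ?thesis
          by (auto simp: cyl_dist_def vj cyl_arc_iff[OF n] intro!: exI[of _ k] exI[of _ a])
      qed
    qed
    then obtain k c where "((i, a), (k, c)) \<in> parcs (Q' n)"
      "cyl_dist n (i, a) v = Suc (cyl_dist n (k, c) v)" by blast
    then show "\<exists>e\<in>arcs (with_proj (Q' n)). tail (with_proj (Q' n)) e = x \<and>
        cyl_dist n x v = Suc (cyl_dist n (head (with_proj (Q' n)) e) v)"
      by (intro bexI[of _ "((i, a), (k, c))"]) (simp_all add: xi)
  qed
qed

section \<open>Summation\<close>

lemma sum_min_complement: "(\<Sum>t<2 * m. min t (2 * m - t)) = m * m" for m :: nat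
proof -
  have "(\<Sum>t<2 * m. min t (2 * m - t)) =
      (\<Sum>t<m. min t (2 * m - t)) + (\<Sum>t=m..<2 * m. min t (2 * m - t))"
    using sum.atLeastLessThan_concat[of 0 m "2 * m" "\<lambda>t. min t (2 * m - t)"]
    by (simp add: atLeast0LessThan)
  also have "(\<Sum>t=m..<2 * m. min t (2 * m - t)) = (\<Sum>s<m. m - s)"
    by (rule sum.reindex_bij_witness[of _ "\<lambda>s. m + s" "\<lambda>t. t - m"]) auto
  also have "(\<Sum>t<m. min t (2 * m - t)) = (\<Sum>t<m. t)"
    by (rule sum.cong) auto
  also have "(\<Sum>t<m. t) + (\<Sum>s<m. m - s) = (\<Sum>t<m. m)"
    by (subst sum.distrib[symmetric]) (rule sum.cong, auto)
  finally show ?thesis by simp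
qed

text \<open>
  The distances, measured in a fixed direction around the ring, from a fixed column to all columns are \<open>0, \<dots>, 2 m - 1\<close>, each once.
\<close>
lemma sum_ring_dist:
  assumes "i \<in> {1..2 * m}"
  shows "(\<Sum>j\<in>{1..2 * m}. ring_dist (2 * m) i j) = m * m"
proof -
  have "(\<Sum>j\<in>{1..2 * m}. ring_dist (2 * m) i j) = (\<Sum>t<2 * m. min t (2 * m - t))"
    by (rule sum.reindex_bij_witness[of _
          "\<lambda>t. if t < i then i - t else 2 * m + i - t"
          "\<lambda>j. if j \<le> i then i - j else 2 * m + i - j"])
      (use assms in \<open>auto simp: ring_dist_def min_def\<close>)
  then show ?thesis by (simp add: sum_min_complement)
qed

lemma sum_detour_row:
  assumes "i \<in> {1..4 * n}"
  shows "(\<Sum>j\<in>{1..4 * n}. detour i j) = (if i mod 4 \<ge> 2 then 4 else 0)"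
proof (cases "i mod 4 \<ge> 2")
  case True
  define q where "q = i div 4"
  have i: "i = 4 * q + 2 \<or> i = 4 * q + 3"
    using True unfolding q_def by presburger
  with assms have "q < n" by auto
  have "(\<Sum>j\<in>{1..4 * n}. detour i j) = (\<Sum>j\<in>{4 * q + 2, 4 * q + 3}. detour i j)"
  proof (rule sum.mono_neutral_right)
    show "{4 * q + 2, 4 * q + 3} \<subseteq> {1..4 * n}" using \<open>q < n\<close> by auto
    show "\<forall>j\<in>{1..4 * n} - {4 * q + 2, 4 * q + 3}. detour i j = 0"
    proof
      fix j assume "j \<in> {1..4 * n} - {4 * q + 2, 4 * q + 3}"
      then have "\<not> (j mod 4 \<ge> 2 \<and> q = j div 4)" by (clarsimp, presburger)
      then show "detour i j = 0" by (auto simp: detour_def q_def)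
    qed
  qed simp
  also have "\<dots> = 4" using detour_within_block[OF i] by simp
  finally show ?thesis using True by simp
next
  case False
  then show ?thesis by (simp add: detour_def)
qed

lemma sum_detour: "(\<Sum>i\<in>{1..4 * n}. \<Sum>j\<in>{1..4 * n}. detour i j) = 8 * n"
proof -
  have "(\<Sum>i\<in>{1..4 * n}. \<Sum>j\<in>{1..4 * n}. detour i j) =
      (\<Sum>i\<in>{1..4 * n}. if i mod 4 \<ge> 2 then 4 else 0)"
    by (rule sum.cong[OF refl]) (rule sum_detour_row)
  also have "\<dots> = 8 * n"
  proof (induct n)
    case (Suc n)
    have "{1..4 * Suc n} = insert (4 * n + 4) (insert (4 * n + 3)
        (insert (4 * n + 2) (insert (4 * n + 1) {1..4 * n})))" by auto
    moreover have "(4 * n + 4) mod 4 = 0" "(4 * n + 3) mod 4 = 3"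
      "(4 * n + 2) mod 4 = 2" "(4 * n + 1) mod 4 = 1" by presburger+
    ultimately show ?case using Suc by simp
  qed simp
  finally show ?thesis .
qed

lemma sum_cyl_dist:
  "(\<Sum>u\<in>cyl_verts n. \<Sum>v\<in>cyl_verts n. cyl_dist n u v) = 64 * n ^ 3 + 32 * n ^ 2 + 16 * n"
proof -
  let ?I = "{1..4 * n}"
  have layers: "(\<Sum>u\<in>cyl_verts n. f u) = (\<Sum>i\<in>?I. f (i, False) + f (i, True))"
    for f :: "nat \<times> bool \<Rightarrow> nat"
    unfolding cyl_verts_def by (simp add: sum.cartesian_product' UNIV_bool add.commute)
  have ring: "(\<Sum>j\<in>?I. ring_dist (4 * n) i j) = 4 * n ^ 2" if "i \<in> ?I" for i
    using sum_ring_dist[of i "2 * n"] that by (simp add: power2_eq_square)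
  have "(\<Sum>u\<in>cyl_verts n. \<Sum>v\<in>cyl_verts n. cyl_dist n u v) =
      (\<Sum>i\<in>?I. \<Sum>j\<in>?I. 4 * ring_dist (4 * n) i j + 2 + 2 * detour i j)"
    unfolding layers sum.distrib[symmetric]
    by (intro sum.cong refl) (simp add: cyl_dist_def)
  also have "\<dots> = (\<Sum>i\<in>?I. 4 * (\<Sum>j\<in>?I. ring_dist (4 * n) i j) + 8 * n + 2 * (\<Sum>j\<in>?I. detour i j))"
    by (rule sum.cong[OF refl]) (simp only: sum.distrib sum_distrib_left[symmetric], simp)
  also have "\<dots> = (\<Sum>i\<in>?I. 16 * n ^ 2 + 8 * n + 2 * (\<Sum>j\<in>?I. detour i j))"
    by (rule sum.cong[OF refl]) (frule ring, linarith)
  also have "\<dots> = 4 * n * (16 * n ^ 2 + 8 * n) + 2 * (8 * n)"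
    by (simp only: sum.distrib sum_distrib_left[symmetric] sum_detour) (simp add: algebra_simps)
  finally show ?thesis by (simp add: algebra_simps power2_eq_square power3_eq_cube)
qed

theorem theorem4p2:
  fixes n :: nat
  assumes "n \<ge> 1"
  shows "wiener_index (with_proj (Q' n)) =
    ereal (32 * real n ^ 3 + 16 * real n ^ 2 + 8 * real n)"
proof -
  let ?P = "{(u, v). u \<in> cyl_verts n \<and> v \<in> cyl_verts n \<and> u < v}"
  let ?S = "\<Sum>(u, v)\<in>?P. cyl_dist n u v"
  have "2 * ?S = 64 * n ^ 3 + 32 * n ^ 2 + 16 * n"
    unfolding sum_cyl_dist[symmetric]
    by (intro sum_less_pairs_symmetric cyl_dist_commute cyl_dist_self) (simp add: cyl_verts_def)
  then have S: "?S = 32 * n ^ 3 + 16 * n ^ 2 + 8 * n" by simp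
  have "wiener_index (with_proj (Q' n)) = (\<Sum>(u, v)\<in>?P. ereal (cyl_dist n u v))"
    unfolding wiener_index_def
    by (rule sum.cong) (auto simp: Q'_def[THEN arg_cong[of _ _ pverts]] graph_dist_cylinder[OF assms])
  also have "\<dots> = ereal ?S"
    by (simp add: case_prod_unfold)
  finally show ?thesis by (simp add: S)
qed

end
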